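(* Let $d\ge 3$, let $q$ be a prime power, let $2\le k\le d/2$, and let $G$ be a group with $\mathrm{PSL}_d(q)\trianglelefteq G\le \mathrm{P}\Gamma\mathrm{L}_d(q)$, acting naturally on the set of $k$-dimensional subspaces of $\mathbb{F}_q^d$. Then $G$ is not $\mathrm{IBIS}$.
   Context: A base of a permutation group $G$ on $\Omega$ is a sequence $(\omega_1,\dots,\omega_\ell)$ of points with trivial pointwise stabilizer; it is irredundant if $G>G_{\omega_1}>\cdots>G_{\omega_1,\dots,\omega_\ell}=1$. $G$ is $\mathrm{IBIS}$ if all irredundant bases of $G$ have the same cardinality. *)

theory Defs
  imports "HOL-Analysis.Analysis" "HOL-Algebra.Bij" "HOL-Algebra.Coset"
begin

text \<open>Permutation groups on a set Omega are represented as subgroups of the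
  HOL-Algebra group BijGroup Omega (bijections of Omega, extensional outside Omega).\<close>

definition pw_stab :: "('a \<Rightarrow> 'a) set \<Rightarrow> 'a list \<Rightarrow> ('a \<Rightarrow> 'a) set" where
  "pw_stab G b = {g \<in> G. \<forall>w \<in> set b. g w = w}"

text \<open>A base: sequence of points of Omega with trivial pointwise stabilizer.\<close>
definition is_base :: "'a set \<Rightarrow> ('a \<Rightarrow> 'a) set \<Rightarrow> 'a list \<Rightarrow> bool" where
  "is_base \<Omega> G b \<longleftrightarrow> set b \<subseteq> \<Omega> \<and> pw_stab G b = {\<one>\<^bsub>BijGroup \<Omega>\<^esub>}"

text \<open>Irredundant base: G > G_w1 > G_w1w2 > ... > G_w1..wl = 1.\<close>
definition irredundant_base :: "'a set \<Rightarrow> ('a \<Rightarrow> 'a) set \<Rightarrow> 'a list \<Rightarrow> bool" where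
  "irredundant_base \<Omega> G b \<longleftrightarrow> is_base \<Omega> G b \<and>
     (\<forall>i < length b. pw_stab G (take (Suc i) b) \<subset> pw_stab G (take i b))"

definition IBIS :: "'a set \<Rightarrow> ('a \<Rightarrow> 'a) set \<Rightarrow> bool" where
  "IBIS \<Omega> G \<longleftrightarrow> (\<forall>b c. irredundant_base \<Omega> G b \<and> irredundant_base \<Omega> G c \<longrightarrow> length b = length c)"

text \<open>Field automorphisms and semilinear bijections of 'f^'n (the group GammaL).\<close>
definition field_aut :: "('f::field \<Rightarrow> 'f) \<Rightarrow> bool" where
  "field_aut \<sigma> \<longleftrightarrow> bij \<sigma> \<and> (\<forall>a b. \<sigma> (a + b) = \<sigma> a + \<sigma> b) \<and> (\<forall>a b. \<sigma> (a * b) = \<sigma> a * \<sigma> b)"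

definition semilinear_bij :: "('f::field ^'n \<Rightarrow> 'f ^'n) \<Rightarrow> bool" where
  "semilinear_bij g \<longleftrightarrow> bij g \<and> (\<forall>x y. g (x + y) = g x + g y) \<and>
     (\<exists>\<sigma>. field_aut \<sigma> \<and> (\<forall>c x. g (c *s x) = \<sigma> c *s g x))"

text \<open>The set of k-dimensional subspaces of 'f^'n.\<close>
definition k_subspaces :: "nat \<Rightarrow> ('f::field ^'n) set set" where
  "k_subspaces k = {W. vec.subspace W \<and> vec.dim W = k}"

text \<open>Induced permutation of a map g on the set Omega of subspaces.\<close>
definition induced_perm :: "('f::field ^'n) set set \<Rightarrow> ('f ^'n \<Rightarrow> 'f ^'n)
    \<Rightarrow> ('f ^'n) set \<Rightarrow> ('f ^'n) set" where
  "induced_perm \<Omega> g = (\<lambda>W \<in> \<Omega>. g ` W)"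

text \<open>PGammaL_d(q) and PSL_d(q) as permutation groups on the k-subspaces.\<close>
definition PGammaL_on :: "nat \<Rightarrow> (('f::field ^'n) set \<Rightarrow> ('f ^'n) set) set" where
  "PGammaL_on k = {induced_perm (k_subspaces k) g | g. semilinear_bij g}"

definition PSL_on :: "nat \<Rightarrow> (('f::field ^'n) set \<Rightarrow> ('f ^'n) set) set" where
  "PSL_on k = {induced_perm (k_subspaces k) (\<lambda>x. A *v x) | A :: 'f^'n^'n. det A = 1}"

end

theory Submission
  imports Defs
begin

text \<open>Write \<open>E(S)\<close> for the coordinate subspace spanned by the standard basis vectors indexed
  by \<open>S\<close>, fix a \<open>k\<close>-set \<open>K\<close> of coordinates and let \<open>F\<close> list the subspaces \<open>E(K - t + j)\<close>
  for \<open>t \<in> K\<close>, \<open>j \<notin> K\<close>. The sequence \<open>E(K), F\<close> is irredundant: the transvection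
  \<open>x\<^sub>j := x\<^sub>j + x\<^sub>t\<close> moves \<open>E(K)\<close>, while \<open>x\<^sub>t := x\<^sub>t + x\<^sub>j\<close> fixes \<open>E(K)\<close> and every member of
  \<open>F\<close> except \<open>E(K - t + j)\<close>. Yet \<open>E(K)\<close> is redundant after \<open>F\<close>: any two coordinates are
  separated by some member of \<open>F\<close>, so a semilinear map fixing all of \<open>F\<close> is diagonal and
  fixes every coordinate subspace. Finitely many further subspaces, each spanned by \<open>k - 1\<close>
  basis vectors and one vector with entries \<open>1\<close> and \<open>a\<close>, force a diagonal semilinear map to be
  scalar, so \<open>F\<close> followed by them is a base. Pruning this base to an irredundant one, with and
  without \<open>E(K)\<close> in front, yields irredundant bases whose lengths differ by one.\<close>

section \<open>Irredundant sequences and pruning\<close>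

definition irredundant :: "('a \<Rightarrow> 'a) set \<Rightarrow> 'a list \<Rightarrow> bool" where
  "irredundant H b \<longleftrightarrow> (\<forall>i < length b. pw_stab H (take (Suc i) b) \<subset> pw_stab H (take i b))"

lemma irredundant_base_iff: "irredundant_base \<Omega> G b \<longleftrightarrow> is_base \<Omega> G b \<and> irredundant G b"
  by (simp add: irredundant_base_def irredundant_def)

lemma pw_stab_Nil [simp]: "pw_stab H [] = H"
  by (simp add: pw_stab_def)

lemma pw_stab_Cons: "pw_stab H (y # ys) = pw_stab {g \<in> H. g y = y} ys"
  by (auto simp: pw_stab_def)

lemma pw_stab_append: "pw_stab H (xs @ ys) = pw_stab (pw_stab H xs) ys"
  by (auto simp: pw_stab_def)

lemma irredundant_Nil [simp]: "irredundant H []"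
  by (simp add: irredundant_def)

lemma irredundant_Cons:
  "irredundant H (y # ys) \<longleftrightarrow> {g \<in> H. g y = y} \<subset> H \<and> irredundant {g \<in> H. g y = y} ys"
  by (simp add: irredundant_def All_less_Suc2 pw_stab_Cons)

text \<open>The first argument is the pointwise stabiliser of the points kept so far.\<close>

fun prune :: "('a \<Rightarrow> 'a) set \<Rightarrow> 'a list \<Rightarrow> 'a list" where
  "prune H [] = []"
| "prune H (y # ys) =
     (if {g \<in> H. g y = y} \<subset> H then y # prune {g \<in> H. g y = y} ys else prune H ys)"

lemma set_prune: "set (prune H ys) \<subseteq> set ys"
  by (induction H ys rule: prune.induct) auto

lemma length_prune: "length (prune H ys) \<le> length ys"
  by (induction H ys rule: prune.induct) auto

lemma pw_stab_prune: "pw_stab H (prune H ys) = pw_stab H ys"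
proof (induction H ys rule: prune.induct)
  case (2 H y ys)
  then show ?case
    by (cases "{g \<in> H. g y = y} \<subset> H") (auto simp: pw_stab_Cons)
qed simp

lemma irredundant_prune: "irredundant H (prune H ys)"
  by (induction H ys rule: prune.induct) (auto simp: irredundant_Cons)

lemma prune_irredundant: "irredundant H ys \<Longrightarrow> prune H ys = ys"
  by (induction H ys rule: prune.induct) (auto simp: irredundant_Cons)

lemma prune_append: "prune H (xs @ ys) = prune H xs @ prune (pw_stab H xs) ys"
  by (induction H xs rule: prune.induct) (auto simp: pw_stab_Cons)

lemma irredundant_base_prune:
  assumes "is_base \<Omega> G b"
  shows "irredundant_base \<Omega> G (prune G b)"
  using assms set_prune[of G b] pw_stab_prune[of G b] irredundant_prune[of G b]
  by (auto simp: irredundant_base_iff is_base_def)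

text \<open>Pruning \<open>F @ E\<close> and \<open>x # F @ E\<close> keeps \<open>x # F\<close> and prunes \<open>E\<close> relative to the same
  stabiliser in both cases, so the second irredundant base is longer by one.\<close>

lemma not_IBIS_if_redundant_point:
  assumes base: "is_base \<Omega> G (F @ E)" and "x \<in> \<Omega>"
    and irr: "irredundant G (x # F)"
    and fix_x: "\<forall>g \<in> pw_stab G F. g x = x"
  shows "\<not> IBIS \<Omega> G"
proof -
  have stab_eq: "pw_stab G (x # F) = pw_stab G F"
    using fix_x by (auto simp: pw_stab_def)
  then have "pw_stab G ((x # F) @ E) = pw_stab G (F @ E)"
    by (simp only: pw_stab_append)
  then have "is_base \<Omega> G ((x # F) @ E)"
    using base \<open>x \<in> \<Omega>\<close> by (simp add: is_base_def)
  then have "irredundant_base \<Omega> G (prune G ((x # F) @ E))"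
    by (rule irredundant_base_prune)
  moreover have "irredundant_base \<Omega> G (prune G (F @ E))"
    using base by (rule irredundant_base_prune)
  moreover have "length (prune G (F @ E)) < length (prune G ((x # F) @ E))"
  proof -
    have "prune G ((x # F) @ E) = (x # F) @ prune (pw_stab G F) E"
      by (simp only: prune_append prune_irredundant[OF irr] stab_eq)
    then show ?thesis
      using length_prune[of G F] by (simp add: prune_append)
  qed
  ultimately show ?thesis
    unfolding IBIS_def by (metis less_irrefl)
qed

lemma irredundant_map_if_independent:
  assumes "distinct ps"
    and "\<forall>p \<in> set ps. \<exists>g \<in> H. g (f p) \<noteq> f p \<and> (\<forall>p' \<in> set ps. p' \<noteq> p \<longrightarrow> g (f p') = f p')"
  shows "irredundant H (map f ps)"
  using assms
proof (induction ps arbitrary: H)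
  case (Cons p ps)
  let ?H' = "{g \<in> H. g (f p) = f p}"
  have "?H' \<subset> H"
    using Cons.prems(2) by auto
  moreover have "irredundant ?H' (map f ps)"
  proof (rule Cons.IH)
    show "distinct ps"
      using Cons.prems(1) by simp
    show "\<forall>p' \<in> set ps. \<exists>g \<in> ?H'. g (f p') \<noteq> f p' \<and> (\<forall>p'' \<in> set ps. p'' \<noteq> p' \<longrightarrow> g (f p'') = f p'')"
      using Cons.prems by (metis (mono_tags, lifting) distinct.simps(2) list.set_intros mem_Collect_eq)
  qed
  ultimately show ?case
    by (simp add: irredundant_Cons)
qed simp

section \<open>Coordinate subspaces and probe subspaces\<close>

definition coord_subspace :: "'n set \<Rightarrow> ('f::field ^'n) set" where
  "coord_subspace S = vec.span ((\<lambda>i. axis i 1) ` S)"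

lemma coord_subspace_nth_eq_0:
  assumes "x \<in> coord_subspace S" "j \<notin> S"
  shows "x $ j = 0"
proof -
  have "coord_subspace S \<subseteq> {x. x $ j = 0}"
    unfolding coord_subspace_def
    by (rule vec.span_minimal) (auto simp: vec.subspace_def axis_def assms(2))
  then show ?thesis
    using assms(1) by auto
qed

lemma axis_in_coord_subspace: "i \<in> S \<Longrightarrow> axis i 1 \<in> coord_subspace S"
  unfolding coord_subspace_def by (rule vec.span_base) simp

lemma independent_axes: "vec.independent ((\<lambda>i. axis i (1::'f::field)) ` (S :: 'n::finite set))"
  by (rule vec.independent_mono[OF independent_cart_basis]) (auto simp: cart_basis_def)

lemma card_axes: "card ((\<lambda>i. axis i (1::'f::field)) ` (S :: 'n::finite set)) = card S"
  by (rule card_image) (auto simp: inj_on_def axis_eq_axis)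

lemma coord_subspace_in_k_subspaces:
  "card (S :: 'n::finite set) = k \<Longrightarrow> (coord_subspace S :: ('f::field ^'n) set) \<in> k_subspaces k"
  unfolding k_subspaces_def coord_subspace_def
  by (simp add: vec.dim_eq_card_independent[OF independent_axes] card_axes)

definition probe_vec :: "'n set \<Rightarrow> 'n \<Rightarrow> 'f \<Rightarrow> 'f::field ^'n" where
  "probe_vec Y p a = (\<chi> i. if i \<in> Y then 0 else if i = p then a else 1)"

definition probe_subspace :: "'n set \<Rightarrow> 'n \<Rightarrow> 'f \<Rightarrow> ('f::field ^'n) set" where
  "probe_subspace Y p a = vec.span (insert (probe_vec Y p a) ((\<lambda>i. axis i 1) ` Y))"

lemma probe_vec_in_probe_subspace: "probe_vec Y p a \<in> probe_subspace Y p a"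
  unfolding probe_subspace_def by (rule vec.span_base) simp

lemma probe_subspace_nth:
  assumes "x \<in> probe_subspace Y p a" "q \<notin> Y" "q \<noteq> p" "i \<notin> Y"
  shows "x $ i = (if i = p then a else 1) * x $ q"
proof -
  let ?T = "{x. \<forall>i. i \<notin> Y \<longrightarrow> x $ i = (if i = p then a else 1) * x $ q}"
  have "vec.subspace ?T"
    unfolding vec.subspace_def
  proof (intro conjI ballI allI)
    show "0 \<in> ?T"
      by simp
    show "x + y \<in> ?T" if "x \<in> ?T" "y \<in> ?T" for x y
      using that by (simp add: distrib_left)
    show "c *s x \<in> ?T" if "x \<in> ?T" for c x
      using that by (simp add: mult.left_commute)
  qed
  moreover have "insert (probe_vec Y p a) ((\<lambda>i. axis i 1) ` Y) \<subseteq> ?T"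
    using assms(2,3) by (auto simp: probe_vec_def axis_def)
  ultimately have "probe_subspace Y p a \<subseteq> ?T"
    unfolding probe_subspace_def by (intro vec.span_minimal)
  then show ?thesis
    using assms(1,4) by blast
qed

lemma probe_subspace_in_k_subspaces:
  assumes "card Y + 1 = k" "q \<notin> Y" "q \<noteq> p"
  shows "(probe_subspace Y p a :: ('f::field ^'n::finite) set) \<in> k_subspaces k"
proof -
  let ?B = "(\<lambda>i. axis i (1::'f)) ` Y"
  have "probe_vec Y p a $ q \<noteq> 0"
    using assms(2,3) by (simp add: probe_vec_def)
  then have not_in_span: "probe_vec Y p a \<notin> coord_subspace Y"
    using coord_subspace_nth_eq_0[OF _ assms(2)] by metis
  then have "vec.independent (insert (probe_vec Y p a) ?B)"
    unfolding coord_subspace_def by (rule vec.independent_insertI[OF _ independent_axes])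
  then have "vec.dim (probe_subspace Y p a) = card (insert (probe_vec Y p a) ?B)"
    unfolding probe_subspace_def by (rule vec.dim_span_eq_card_independent)
  also have "\<dots> = Suc (card ?B)"
    using not_in_span by (intro card_insert_disjoint) (auto simp: axis_in_coord_subspace)
  also have "\<dots> = k"
    using assms(1) by (simp add: card_axes)
  finally show ?thesis
    unfolding k_subspaces_def probe_subspace_def by simp
qed

section \<open>Semilinear maps\<close>

lemma field_aut_1:
  assumes "field_aut \<sigma>"
  shows "\<sigma> 1 = 1"
proof -
  have "Modules.additive \<sigma>" "inj \<sigma>"
    using assms by (auto simp: field_aut_def Modules.additive_def bij_def)
  then have "\<sigma> 1 \<noteq> \<sigma> 0"
    by (simp add: inj_eq)
  then have "\<sigma> 1 \<noteq> 0"
    using Modules.additive.zero[OF \<open>Modules.additive \<sigma>\<close>] by simp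
  moreover have "\<sigma> 1 = \<sigma> 1 * \<sigma> 1"
    using assms unfolding field_aut_def by (metis mult_1)
  ultimately show ?thesis
    by simp
qed

text \<open>\<open>Modules.additive\<close> is qualified because HOL-Analysis also has a constant \<open>additive\<close>
  for set functions.\<close>

lemma semilinear_bijE:
  assumes "semilinear_bij g"
  obtains \<sigma> where "field_aut \<sigma>" "Modules.additive g" "\<And>c x. g (c *s x) = \<sigma> c *s g x" "inj g"
  using assms unfolding semilinear_bij_def bij_def Modules.additive_def by blast

lemma semilinear_bij_inj: "semilinear_bij g \<Longrightarrow> inj g"
  by (simp add: semilinear_bij_def bij_def)

lemma semilinear_bij_matrix_vector_mult:
  fixes A :: "'f::field ^'n::finite^'n"
  assumes "invertible A"
  shows "semilinear_bij ((*v) A)"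
proof -
  have "field_aut (id :: 'f \<Rightarrow> 'f)"
    by (simp add: field_aut_def)
  moreover have "surj ((*v) A)"
  proof -
    obtain B where "A ** B = mat 1"
      using assms unfolding invertible_def by blast
    then have "A *v (B *v y) = y" for y
      by (simp add: matrix_vector_mul_assoc)
    then show ?thesis
      by (rule surjI)
  qed
  ultimately show ?thesis
    using inj_matrix_vector_mult[OF assms]
    by (auto simp: semilinear_bij_def bij_def matrix_vector_right_distrib vector_scalar_commute)
qed

lemma semilinear_bij_image_span_eq:
  fixes g :: "'f::{finite,field} ^'n::finite \<Rightarrow> 'f ^'n"
  assumes "semilinear_bij g" "g ` B \<subseteq> vec.span B"
  shows "g ` vec.span B = vec.span B"
proof -
  obtain \<sigma> where "field_aut \<sigma>" and add: "Modules.additive g"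
    and scale: "\<And>c x. g (c *s x) = \<sigma> c *s g x" and "inj g"
    using semilinear_bijE[OF assms(1)] by blast
  have "vec.span B \<subseteq> {x. g x \<in> vec.span B}"
  proof (rule vec.span_minimal)
    show "B \<subseteq> {x. g x \<in> vec.span B}"
      using assms(2) by auto
    show "vec.subspace {x. g x \<in> vec.span B}"
      using Modules.additive.zero[OF add] Modules.additive.add[OF add] scale
      by (auto simp: vec.subspace_def intro: vec.span_add vec.span_scale vec.span_zero)
  qed
  then have "g ` vec.span B \<subseteq> vec.span B"
    by auto
  moreover have "inj_on g (vec.span B)"
    using \<open>inj g\<close> by (rule inj_on_subset) simp
  ultimately show ?thesis
    by (intro endo_inj_surj) simp_all
qed

lemma semilinear_diagonal_apply:
  fixes g :: "'f::field ^'n::finite \<Rightarrow> 'f ^'n"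
  assumes add: "Modules.additive g" and scale: "\<And>d x. g (d *s x) = \<sigma> d *s g x"
    and diag: "\<And>i. g (axis i 1) = c i *s axis i 1"
  shows "g x = (\<chi> i. \<sigma> (x $ i) * c i)"
proof -
  have "g x = g (\<Sum>i\<in>UNIV. x $ i *s axis i 1)"
    by (simp add: basis_expansion)
  also have "\<dots> = (\<Sum>i\<in>UNIV. (\<sigma> (x $ i) * c i) *s axis i 1)"
    by (simp add: Modules.additive.sum[OF add] scale diag)
  also have "\<dots> = (\<chi> i. \<sigma> (x $ i) * c i)"
    using basis_expansion[of "\<chi> i. \<sigma> (x $ i) * c i"] by simp
  finally show ?thesis .
qed

lemma diagonal_if_fixes_separating_coord_subspaces:
  assumes "\<And>i l. i \<noteq> l \<Longrightarrow> \<exists>S \<in> \<S>. i \<in> S \<and> l \<notin> S"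
    and "\<And>S. S \<in> \<S> \<Longrightarrow> g ` coord_subspace S \<subseteq> coord_subspace S"
  shows "g (axis i 1) = g (axis i 1) $ i *s (axis i 1 :: 'f::field ^'n)"
proof -
  have "g (axis i 1) $ l = 0" if "l \<noteq> i" for l
  proof -
    from assms(1)[of i l] that obtain S where "S \<in> \<S>" "i \<in> S" "l \<notin> S"
      by auto
    then show ?thesis
      using assms(2) axis_in_coord_subspace coord_subspace_nth_eq_0 by blast
  qed
  then show ?thesis
    by (auto simp: vec_eq_iff axis_def)
qed

lemma diagonal_coeffs_if_fixes_probe_subspace:
  fixes g :: "'f::field ^'n \<Rightarrow> 'f ^'n"
  assumes diag: "\<And>x. g x = (\<chi> i. \<sigma> (x $ i) * c i)" and "\<sigma> 1 = 1"
    and "g ` probe_subspace Y p a \<subseteq> probe_subspace Y p a" and "q \<notin> Y" "q \<noteq> p" "i \<notin> Y"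
  shows "\<sigma> (probe_vec Y p a $ i) * c i = (if i = p then a else 1) * c q"
proof -
  have "g (probe_vec Y p a) \<in> probe_subspace Y p a"
    using assms(3) probe_vec_in_probe_subspace by blast
  then have "g (probe_vec Y p a) $ i = (if i = p then a else 1) * g (probe_vec Y p a) $ q"
    using assms(4-6) by (rule probe_subspace_nth)
  moreover have "probe_vec Y p a $ q = 1"
    using assms(4,5) by (simp add: probe_vec_def)
  ultimately show ?thesis
    using diag assms(2) by simp
qed

lemma diagonal_scalar_if_fixes_probe_subspaces:
  fixes g :: "'f::field ^'n \<Rightarrow> 'f ^'n"
  assumes g_apply: "\<And>x. g x = (\<chi> i. \<sigma> (x $ i) * c i)" and \<sigma>1: "\<sigma> 1 = 1" and "c q \<noteq> 0"
    and fix1: "\<And>a. g ` probe_subspace Y1 p a \<subseteq> probe_subspace Y1 p a"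
    and fix2: "g ` probe_subspace Y2 p 1 \<subseteq> probe_subspace Y2 p 1"
    and "Y1 \<inter> Y2 = {}" "p \<notin> Y1" "q \<notin> Y1" "q \<notin> Y2" "q \<noteq> p"
  shows "g x = c q *s x"
proof -
  have c_eq: "c i = c q" for i
  proof (cases "i \<in> Y1")
    case True
    then have "i \<notin> Y2"
      using \<open>Y1 \<inter> Y2 = {}\<close> by blast
    then show ?thesis
      using diagonal_coeffs_if_fixes_probe_subspace[OF g_apply \<sigma>1 fix2 \<open>q \<notin> Y2\<close> \<open>q \<noteq> p\<close>]
      by (simp add: probe_vec_def \<sigma>1)
  next
    case False
    then show ?thesis
      using diagonal_coeffs_if_fixes_probe_subspace[OF g_apply \<sigma>1 fix1 \<open>q \<notin> Y1\<close> \<open>q \<noteq> p\<close>, where a = 1]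
      by (simp add: probe_vec_def \<sigma>1)
  qed
  have \<sigma>_id: "\<sigma> a = a" for a
  proof -
    have "\<sigma> a * c p = a * c q"
      using diagonal_coeffs_if_fixes_probe_subspace[OF g_apply \<sigma>1 fix1 \<open>q \<notin> Y1\<close> \<open>q \<noteq> p\<close> \<open>p \<notin> Y1\<close>]
      by (simp add: probe_vec_def \<open>p \<notin> Y1\<close>)
    then show ?thesis
      using c_eq[of p] \<open>c q \<noteq> 0\<close> by simp
  qed
  have "g x $ i = c q * x $ i" for i
    using c_eq[of i] by (simp add: g_apply \<sigma>_id mult.commute)
  then show ?thesis
    by (simp add: vec_eq_iff)
qed

lemma semilinear_bij_scalar_if_fixes_probe_subspaces:
  fixes g :: "'f::field ^'n::finite \<Rightarrow> 'f ^'n"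
  assumes "semilinear_bij g" and diag: "\<And>i. g (axis i 1) = c i *s axis i 1"
    and "\<And>a. g ` probe_subspace Y1 p a \<subseteq> probe_subspace Y1 p a"
    and "g ` probe_subspace Y2 p 1 \<subseteq> probe_subspace Y2 p 1"
    and "Y1 \<inter> Y2 = {}" "p \<notin> Y1" "q \<notin> Y1" "q \<notin> Y2" "q \<noteq> p"
  shows "g x = c q *s x"
proof -
  obtain \<sigma> where \<sigma>: "field_aut \<sigma>" and add: "Modules.additive g"
    and scale: "\<And>d x. g (d *s x) = \<sigma> d *s g x" and "inj g"
    using semilinear_bijE[OF assms(1)] by blast
  have "c q \<noteq> 0"
  proof
    assume "c q = 0"
    then have "g (axis q 1) = g 0"
      using diag Modules.additive.zero[OF add] by simp
    then have "axis q (1::'f) = 0"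
      using \<open>inj g\<close> by (simp add: inj_eq)
    then show False
      by simp
  qed
  show ?thesis
    by (rule diagonal_scalar_if_fixes_probe_subspaces[OF semilinear_diagonal_apply[OF add scale diag]
          field_aut_1[OF \<sigma>] \<open>c q \<noteq> 0\<close> assms(3-9)])
qed

lemma semilinear_bij_image_coord_subspace:
  fixes g :: "'f::{finite,field} ^'n::finite \<Rightarrow> 'f ^'n"
  assumes "semilinear_bij g" "\<And>i. i \<in> S \<Longrightarrow> g (axis i 1) \<in> coord_subspace S"
  shows "g ` coord_subspace S = coord_subspace S"
  using assms unfolding coord_subspace_def by (intro semilinear_bij_image_span_eq) auto

section \<open>Transvections and exchanged coordinate subspaces\<close>

definition transvection :: "'n \<Rightarrow> 'n \<Rightarrow> 'f::field ^'n^'n" where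
  "transvection a b = (\<chi> r. if r = a then row a (mat 1) + row b (mat 1) else row r (mat 1))"

lemma det_transvection: "a \<noteq> b \<Longrightarrow> det (transvection a b :: 'f::field ^'n::finite^'n) = 1"
  unfolding transvection_def using det_row_operation[of a b "mat 1 :: 'f^'n^'n" 1, unfolded vector_smult_lid]
  by simp

lemma transvection_nth:
  "(transvection a b :: 'f::field ^'n::finite^'n) $ r $ j =
     (if r = a then (if j = a then 1 else 0) + (if j = b then 1 else 0) else if j = r then 1 else 0)"
  by (simp add: transvection_def row_def mat_def)

lemma transvection_mult_vec:
  "transvection a b *v x = (\<chi> r. if r = a then x $ a + x $ b else (x :: 'f::field ^'n::finite) $ r)"
  by (simp add: vec_eq_iff matrix_vector_mult_def transvection_nth distrib_right sum.distrib
      if_distrib[of "\<lambda>t. t * _"] cong: if_cong)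

lemma transvection_mult_axis:
  "a \<noteq> b \<Longrightarrow> transvection a b *v axis s (1::'f::field) =
     (if s = b then axis b 1 + axis a 1 else axis s 1 :: 'f ^'n::finite)"
  by (auto simp: transvection_mult_vec vec_eq_iff axis_def)

lemma transvection_image_coord_subspace:
  assumes "a \<noteq> b" "b \<notin> S \<or> a \<in> S"
  shows "(*v) (transvection a b) ` coord_subspace S = (coord_subspace S :: ('f::{finite,field} ^'n::finite) set)"
proof (rule semilinear_bij_image_coord_subspace)
  show "semilinear_bij ((*v) (transvection a b :: 'f ^'n^'n))"
    using assms(1) by (simp add: semilinear_bij_matrix_vector_mult invertible_det_nz det_transvection)
  show "transvection a b *v axis i 1 \<in> coord_subspace S" if "i \<in> S" for i
    using assms that
    by (auto simp: transvection_mult_axis coord_subspace_def intro: vec.span_add vec.span_base)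
qed

lemma transvection_moves_coord_subspace:
  assumes "a \<noteq> b" "b \<in> S" "a \<notin> S"
  shows "(*v) (transvection a b) ` coord_subspace S \<noteq> (coord_subspace S :: ('f::field ^'n::finite) set)"
proof
  assume eq: "(*v) (transvection a b) ` coord_subspace S = (coord_subspace S :: ('f ^'n) set)"
  have "transvection a b *v axis b 1 \<in> (*v) (transvection a b) ` (coord_subspace S :: ('f ^'n) set)"
    by (intro imageI axis_in_coord_subspace assms(2))
  then have "(transvection a b *v axis b 1) $ a = (0::'f)"
    unfolding eq using assms(3) by (rule coord_subspace_nth_eq_0)
  then show False
    using assms(1) by (simp add: transvection_mult_axis) (simp add: axis_def)
qed

lemma induced_transvection_in_PSL_on:
  "a \<noteq> b \<Longrightarrow> induced_perm (k_subspaces k) ((*v) (transvection a b))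
     \<in> (PSL_on k :: (('f::field ^'n::finite) set \<Rightarrow> _) set)"
  unfolding PSL_on_def using det_transvection by blast

lemma induced_perm_apply: "W \<in> \<Omega> \<Longrightarrow> induced_perm \<Omega> g W = g ` W"
  by (simp add: induced_perm_def)

definition exchange :: "'n set \<Rightarrow> 'n \<Rightarrow> 'n \<Rightarrow> 'n set" where
  "exchange K t j = insert j (K - {t})"

lemma card_exchange: "finite K \<Longrightarrow> t \<in> K \<Longrightarrow> j \<notin> K \<Longrightarrow> card (exchange K t j) = card K"
  using card_Suc_Diff1[of K t] by (simp add: exchange_def)

lemma ex_other_if_two_le_card:
  assumes "2 \<le> card A"
  shows "\<exists>y \<in> A. y \<noteq> x"
proof (rule ccontr)
  assume "\<not> ?thesis"
  then have "A \<subseteq> {x}"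
    by blast
  then have "card A \<le> 1"
    using card_mono[of "{x}" A] by simp
  with assms show False
    by simp
qed

lemma exchange_separates:
  fixes K :: "'n::finite set"
  assumes "2 \<le> card K" "2 \<le> card (UNIV - K)" "i \<noteq> l"
  shows "\<exists>t \<in> K. \<exists>j \<in> UNIV - K. i \<in> exchange K t j \<and> l \<notin> exchange K t j"
proof (cases "i \<in> K")
  case True
  obtain t where "t \<in> K" "t \<noteq> i"
    using ex_other_if_two_le_card[OF assms(1)] by blast
  obtain j where "j \<in> UNIV - K" "j \<noteq> l"
    using ex_other_if_two_le_card[OF assms(2)] by blast
  show ?thesis
  proof (cases "l \<in> K")
    case True
    with \<open>i \<in> K\<close> \<open>j \<in> UNIV - K\<close> assms(3) show ?thesis
      by (intro bexI[of _ l] bexI[of _ j]) (auto simp: exchange_def)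
  next
    case False
    with \<open>i \<in> K\<close> \<open>t \<in> K\<close> \<open>t \<noteq> i\<close> \<open>j \<in> UNIV - K\<close> \<open>j \<noteq> l\<close> show ?thesis
      by (intro bexI[of _ t] bexI[of _ j]) (auto simp: exchange_def)
  qed
next
  case False
  obtain t where "t \<in> K"
    using assms(1) by fastforce
  show ?thesis
  proof (cases "l \<in> K")
    case True
    with False assms(3) show ?thesis
      by (intro bexI[of _ l] bexI[of _ i]) (auto simp: exchange_def)
  next
    case False
    with \<open>i \<notin> K\<close> \<open>t \<in> K\<close> assms(3) show ?thesis
      by (intro bexI[of _ t] bexI[of _ i]) (auto simp: exchange_def)
  qed
qed

lemma coord_subspace_exchange_in_k_subspaces:
  "card K = k \<Longrightarrow> t \<in> K \<Longrightarrow> j \<notin> K \<Longrightarrow>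
     (coord_subspace (exchange K t j) :: ('f::field ^'n::finite) set) \<in> k_subspaces k"
  by (simp add: card_exchange coord_subspace_in_k_subspaces)

lemma transvection_fixes_coord_subspace_exchange_iff:
  assumes "t \<in> K" "j \<notin> K" "t' \<in> K" "j' \<notin> K"
  shows "(*v) (transvection t j) ` coord_subspace (exchange K t' j')
      = (coord_subspace (exchange K t' j') :: ('f::{finite,field} ^'n::finite) set)
    \<longleftrightarrow> (t', j') \<noteq> (t, j)"
proof -
  have "t \<noteq> j"
    using assms(1,2) by blast
  show ?thesis
  proof
    assume fixed: "(*v) (transvection t j) ` coord_subspace (exchange K t' j')
      = (coord_subspace (exchange K t' j') :: ('f ^'n) set)"
    show "(t', j') \<noteq> (t, j)"
    proof
      assume "(t', j') = (t, j)"
      then have "j \<in> exchange K t' j'" "t \<notin> exchange K t' j'"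
        using \<open>t \<noteq> j\<close> by (auto simp: exchange_def)
      then have "(*v) (transvection t j) ` coord_subspace (exchange K t' j')
        \<noteq> (coord_subspace (exchange K t' j') :: ('f ^'n) set)"
        by (rule transvection_moves_coord_subspace[OF \<open>t \<noteq> j\<close>])
      with fixed show False
        by contradiction
    qed
  next
    assume "(t', j') \<noteq> (t, j)"
    then have "j \<notin> exchange K t' j' \<or> t \<in> exchange K t' j'"
      using assms \<open>t \<noteq> j\<close> by (auto simp: exchange_def)
    then show "(*v) (transvection t j) ` coord_subspace (exchange K t' j')
      = (coord_subspace (exchange K t' j') :: ('f ^'n) set)"
      by (rule transvection_image_coord_subspace[OF \<open>t \<noteq> j\<close>])
  qed
qed

section \<open>Stabilisers in \<open>P\<Gamma>L\<close>\<close>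

lemma induced_perm_scalar_eq_one:
  fixes g :: "'f::{finite,field} ^'n::finite \<Rightarrow> 'f ^'n"
  assumes "inj g" "\<And>x. g x = c *s x"
  shows "induced_perm (k_subspaces k) g = \<one>\<^bsub>BijGroup (k_subspaces k)\<^esub>"
proof -
  have invariant: "g ` W = W" if "W \<in> k_subspaces k" for W
  proof (rule endo_inj_surj)
    show "g ` W \<subseteq> W"
      using that assms(2) by (auto simp: k_subspaces_def vec.subspace_scale)
    show "inj_on g W"
      using assms(1) by (rule inj_on_subset) simp
  qed simp
  have "(\<lambda>W \<in> k_subspaces k. W) = \<one>\<^bsub>BijGroup (k_subspaces k)\<^esub>"
    by (simp add: BijGroup_def)
  then show ?thesis
    unfolding induced_perm_def by (simp add: invariant cong: restrict_cong)
qed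

lemma pw_stab_coord_subspace_exchangesE:
  fixes G :: "(('f::{finite,field} ^'n::finite) set \<Rightarrow> ('f ^'n) set) set"
  assumes "G \<subseteq> PGammaL_on k" "card K = k" "2 \<le> card K" "2 \<le> card (UNIV - K)"
    and "set ps = K \<times> (UNIV - K)"
    and "g \<in> pw_stab G (map (\<lambda>(t, j). coord_subspace (exchange K t j)) ps)"
  obtains g0 c where "semilinear_bij g0" "g = induced_perm (k_subspaces k) g0"
    "\<And>i. g0 (axis i 1) = c i *s axis i 1"
proof -
  obtain g0 where g0: "semilinear_bij g0" "g = induced_perm (k_subspaces k) g0"
    using assms(1,6) by (auto simp: pw_stab_def PGammaL_on_def)
  let ?S = "{exchange K t j | t j. t \<in> K \<and> j \<notin> K}"
  have separates: "\<exists>S \<in> ?S. i \<in> S \<and> l \<notin> S" if "i \<noteq> l" for i l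
    using exchange_separates[OF assms(3,4) that] by blast
  have invariant: "g0 ` coord_subspace S \<subseteq> coord_subspace S" if "S \<in> ?S" for S
  proof -
    from that obtain t j where S: "S = exchange K t j" "t \<in> K" "j \<notin> K"
      by blast
    then have "coord_subspace S \<in> set (map (\<lambda>(t, j). coord_subspace (exchange K t j)) ps)"
      using assms(5) by force
    then have "g (coord_subspace S) = coord_subspace S"
      using assms(6) unfolding pw_stab_def by blast
    moreover have "(coord_subspace S :: ('f ^'n) set) \<in> k_subspaces k"
      unfolding S(1) using assms(2) S(2,3) by (rule coord_subspace_exchange_in_k_subspaces)
    ultimately show ?thesis
      using g0(2) by (simp add: induced_perm_apply)
  qed
  have "g0 (axis i 1) = g0 (axis i 1) $ i *s axis i 1" for i
    by (rule diagonal_if_fixes_separating_coord_subspaces[OF separates invariant])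
  with g0 show thesis
    by (rule that)
qed

lemma pw_stab_coord_subspace_exchanges_fixes_coord_subspaces:
  fixes G :: "(('f::{finite,field} ^'n::finite) set \<Rightarrow> ('f ^'n) set) set"
  assumes "G \<subseteq> PGammaL_on k" "card K = k" "2 \<le> card K" "2 \<le> card (UNIV - K)"
    and "set ps = K \<times> (UNIV - K)"
    and "g \<in> pw_stab G (map (\<lambda>(t, j). coord_subspace (exchange K t j)) ps)"
    and "card S = k"
  shows "g (coord_subspace S) = coord_subspace S"
proof -
  obtain g0 c where g0: "semilinear_bij g0" "g = induced_perm (k_subspaces k) g0"
    and diag: "\<And>i. g0 (axis i 1) = c i *s axis i 1"
    using pw_stab_coord_subspace_exchangesE[OF assms(1-6)] by blast
  have "g0 ` coord_subspace S = coord_subspace S"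
  proof (rule semilinear_bij_image_coord_subspace[OF g0(1)])
    show "g0 (axis i 1) \<in> coord_subspace S" if "i \<in> S" for i
      unfolding diag coord_subspace_def using that by (intro vec.span_scale vec.span_base) simp
  qed
  then show ?thesis
    using assms(7) g0(2) by (simp add: induced_perm_apply coord_subspace_in_k_subspaces)
qed

lemma irredundant_coord_subspace_exchanges:
  fixes G :: "(('f::{finite,field} ^'n::finite) set \<Rightarrow> ('f ^'n) set) set"
  assumes "PSL_on k \<subseteq> G" "card K = k" "K \<noteq> {}" "K \<noteq> UNIV"
    and "set ps = K \<times> (UNIV - K)" "distinct ps"
  shows "irredundant G (coord_subspace K # map (\<lambda>(t, j). coord_subspace (exchange K t j)) ps)"
proof -
  define \<tau> where "\<tau> a b = induced_perm (k_subspaces k) ((*v) (transvection a b :: 'f ^'n^'n))"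
    for a b
  have \<tau>_in_G: "\<tau> a b \<in> G" if "a \<noteq> b" for a b
    using induced_transvection_in_PSL_on[OF that] assms(1) unfolding \<tau>_def by blast
  have \<tau>_apply: "\<tau> a b W = (*v) (transvection a b) ` W" if "W \<in> k_subspaces k" for a b W
    using that unfolding \<tau>_def by (rule induced_perm_apply)
  have K_in: "(coord_subspace K :: ('f ^'n) set) \<in> k_subspaces k"
    using assms(2) by (rule coord_subspace_in_k_subspaces)
  let ?H = "{g \<in> G. g (coord_subspace K) = coord_subspace K}"
  let ?f = "\<lambda>(t, j). coord_subspace (exchange K t j) :: ('f ^'n) set"
  obtain t j where "t \<in> K" "j \<notin> K"
    using assms(3,4) by blast
  then have "j \<noteq> t"
    by blast
  have "\<tau> j t (coord_subspace K) \<noteq> coord_subspace K"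
    using \<open>t \<in> K\<close> \<open>j \<notin> K\<close>
    by (simp add: \<tau>_apply[OF K_in] transvection_moves_coord_subspace[OF \<open>j \<noteq> t\<close>])
  then have "\<tau> j t \<in> G - ?H"
    using \<tau>_in_G[OF \<open>j \<noteq> t\<close>] by blast
  then have "?H \<subset> G"
    by blast
  moreover have "irredundant ?H (map ?f ps)"
  proof (rule irredundant_map_if_independent[OF assms(6)], intro ballI)
    fix p
    assume "p \<in> set ps"
    then obtain t j where p: "p = (t, j)" "t \<in> K" "j \<notin> K"
      using assms(5) by auto
    then have "t \<noteq> j"
      by blast
    have "\<tau> t j \<in> ?H"
      using \<tau>_in_G[OF \<open>t \<noteq> j\<close>] \<open>j \<notin> K\<close>
      by (simp add: \<tau>_apply[OF K_in] transvection_image_coord_subspace[OF \<open>t \<noteq> j\<close>])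
    moreover have fixes_iff: "\<tau> t j (?f p') = ?f p' \<longleftrightarrow> p' \<noteq> p" if p'_in: "p' \<in> set ps" for p'
    proof -
      obtain t' j' where p': "p' = (t', j')" "t' \<in> K" "j' \<notin> K"
        using p'_in assms(5) by auto
      then show ?thesis
        by (simp add: p \<tau>_apply coord_subspace_exchange_in_k_subspaces[OF assms(2)]
            transvection_fixes_coord_subspace_exchange_iff[OF p(2,3) p'(2,3)])
    qed
    moreover have "\<tau> t j (?f p) \<noteq> ?f p"
      by (simp add: fixes_iff[OF \<open>p \<in> set ps\<close>])
    moreover have "\<forall>p' \<in> set ps. p' \<noteq> p \<longrightarrow> \<tau> t j (?f p') = ?f p'"
      by (simp add: fixes_iff)
    ultimately show "\<exists>g \<in> ?H. g (?f p) \<noteq> ?f p \<and> (\<forall>p' \<in> set ps. p' \<noteq> p \<longrightarrow> g (?f p') = ?f p')"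
      by blast
  qed
  ultimately show ?thesis
    by (simp add: irredundant_Cons)
qed

lemma pw_stab_coord_subspace_exchanges_probes:
  fixes G :: "(('f::{finite,field} ^'n::finite) set \<Rightarrow> ('f ^'n) set) set"
  assumes "G \<subseteq> PGammaL_on k"
    and "card K = k" "2 \<le> card K" "2 \<le> card (UNIV - K)" "set ps = K \<times> (UNIV - K)"
    and "card Y1 + 1 = k" "card Y2 + 1 = k" "Y1 \<inter> Y2 = {}" "p \<notin> Y1" "q \<notin> Y1" "q \<notin> Y2" "q \<noteq> p"
    and "g \<in> pw_stab G (map (\<lambda>(t, j). coord_subspace (exchange K t j)) ps)"
    and "\<And>a. g (probe_subspace Y1 p a) = probe_subspace Y1 p a"
    and "g (probe_subspace Y2 p 1) = probe_subspace Y2 p 1"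
  shows "g = \<one>\<^bsub>BijGroup (k_subspaces k)\<^esub>"
proof -
  obtain g0 c where g0: "semilinear_bij g0" "g = induced_perm (k_subspaces k) g0"
    and diag: "\<And>i. g0 (axis i 1) = c i *s axis i 1"
    using pw_stab_coord_subspace_exchangesE[OF assms(1-5,13)] by blast
  have "(probe_subspace Y1 p a :: ('f ^'n) set) \<in> k_subspaces k" for a
    using assms(6,10,12) by (rule probe_subspace_in_k_subspaces)
  then have "g0 ` probe_subspace Y1 p a \<subseteq> probe_subspace Y1 p a" for a
    using assms(14)[of a] by (simp add: g0(2) induced_perm_apply)
  moreover have "(probe_subspace Y2 p 1 :: ('f ^'n) set) \<in> k_subspaces k"
    using assms(7,11,12) by (rule probe_subspace_in_k_subspaces)
  then have "g0 ` probe_subspace Y2 p 1 \<subseteq> probe_subspace Y2 p 1"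
    using assms(15) by (simp add: g0(2) induced_perm_apply)
  ultimately have "g0 x = c q *s x" for x
    by (rule semilinear_bij_scalar_if_fixes_probe_subspaces[OF g0(1) diag _ _ assms(8-12)])
  with semilinear_bij_inj[OF g0(1)]
  have "induced_perm (k_subspaces k) g0 = \<one>\<^bsub>BijGroup (k_subspaces k)\<^esub>"
    by (rule induced_perm_scalar_eq_one)
  then show ?thesis
    by (simp add: g0(2))
qed

lemma is_base_coord_subspace_exchanges_probes:
  fixes G :: "(('f::{finite,field} ^'n::finite) set \<Rightarrow> ('f ^'n) set) set"
  assumes "subgroup G (BijGroup (k_subspaces k))" "G \<subseteq> PGammaL_on k"
    and "card K = k" "2 \<le> card K" "2 \<le> card (UNIV - K)" "set ps = K \<times> (UNIV - K)"
    and "card Y1 + 1 = k" "card Y2 + 1 = k" "Y1 \<inter> Y2 = {}" "p \<notin> Y1" "q \<notin> Y1" "q \<notin> Y2" "q \<noteq> p"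
    and "set E = insert (probe_subspace Y2 p 1) (range (probe_subspace Y1 p))"
  shows "is_base (k_subspaces k) G (map (\<lambda>(t, j). coord_subspace (exchange K t j)) ps @ E)"
proof -
  let ?\<Omega> = "k_subspaces k :: ('f ^'n) set set"
  let ?F = "map (\<lambda>(t, j). coord_subspace (exchange K t j) :: ('f ^'n) set) ps"
  have "set ?F \<subseteq> ?\<Omega>"
  proof
    fix W
    assume "W \<in> set ?F"
    then obtain t j where "t \<in> K" "j \<notin> K" "W = coord_subspace (exchange K t j)"
      using assms(6) by auto
    then show "W \<in> ?\<Omega>"
      by (simp add: coord_subspace_exchange_in_k_subspaces[OF assms(3)])
  qed
  moreover have "(probe_subspace Y1 p a :: ('f ^'n) set) \<in> ?\<Omega>" for a
    using assms(7,11,13) by (rule probe_subspace_in_k_subspaces)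
  moreover have "(probe_subspace Y2 p 1 :: ('f ^'n) set) \<in> ?\<Omega>"
    using assms(8,12,13) by (rule probe_subspace_in_k_subspaces)
  ultimately have sub: "set (?F @ E) \<subseteq> ?\<Omega>"
    using assms(14) by auto
  have "g = \<one>\<^bsub>BijGroup ?\<Omega>\<^esub>" if "g \<in> pw_stab G (?F @ E)" for g
  proof -
    have "g \<in> pw_stab G ?F" "\<And>a. g (probe_subspace Y1 p a) = probe_subspace Y1 p a"
      "g (probe_subspace Y2 p 1) = probe_subspace Y2 p 1"
      using that assms(14) by (auto simp: pw_stab_def)
    then show ?thesis
      by (rule pw_stab_coord_subspace_exchanges_probes[OF assms(2-13)])
  qed
  moreover have "\<one>\<^bsub>BijGroup ?\<Omega>\<^esub> \<in> pw_stab G (?F @ E)"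
  proof -
    have "\<one>\<^bsub>BijGroup ?\<Omega>\<^esub> W = W" if "W \<in> ?\<Omega>" for W
      using that by (simp add: BijGroup_def)
    then show ?thesis
      using subgroup.one_closed[OF assms(1)] sub by (auto simp: pw_stab_def)
  qed
  ultimately show ?thesis
    using sub unfolding is_base_def by blast
qed

lemma obtain_coord_set:
  assumes "2 * k \<le> CARD('n::finite)"
  obtains K :: "'n::finite set" where "card K = k" "k \<le> card (UNIV - K)"
proof -
  obtain K :: "'n set" where "card K = k"
    using obtain_subset_with_card_n[of k "UNIV :: 'n set"] assms by auto
  moreover have "card (UNIV - K) = CARD('n) - card K"
    by (simp add: card_Diff_subset)
  ultimately show thesis
    using that assms by simp
qed

lemma obtain_probe_indices:
  assumes "1 \<le> k" "2 * k \<le> CARD('n::finite)"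
  obtains Y1 Y2 :: "'n::finite set" and p q
  where "card Y1 + 1 = k" "card Y2 + 1 = k" "Y1 \<inter> Y2 = {}" "p \<notin> Y1" "q \<notin> Y1" "q \<notin> Y2" "q \<noteq> p"
proof -
  obtain P :: "'n set" where "card P = 2"
    using obtain_subset_with_card_n[of 2 "UNIV :: 'n set"] assms by auto
  then obtain p q :: 'n where "q \<noteq> p"
    by (metis card_2_iff)
  have "k - 1 \<le> card (UNIV - {p, q})"
    using assms \<open>q \<noteq> p\<close> by (simp add: card_Diff_subset)
  then obtain Y1 where Y1: "Y1 \<subseteq> UNIV - {p, q}" "card Y1 = k - 1"
    by (rule obtain_subset_with_card_n)
  have "card (UNIV - {p, q} - Y1) = CARD('n) - 2 - (k - 1)"
    using Y1 \<open>q \<noteq> p\<close> by (simp add: card_Diff_subset)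
  then have "k - 1 \<le> card (UNIV - {p, q} - Y1)"
    using assms by linarith
  then obtain Y2 where Y2: "Y2 \<subseteq> UNIV - {p, q} - Y1" "card Y2 = k - 1"
    by (rule obtain_subset_with_card_n)
  show thesis
    using that[of Y1 Y2 p q] Y1 Y2 assms(1) \<open>q \<noteq> p\<close> by auto
qed

theorem lemma3p4:
  fixes G :: "(('f::{finite,field} ^'n) set \<Rightarrow> ('f ^'n) set) set"
    and k :: nat
  assumes "CARD('n) \<ge> 3"
    and "2 \<le> k" and "2 * k \<le> CARD('n)"
    and "subgroup G (BijGroup (k_subspaces k :: ('f ^'n) set set))"
    and "G \<subseteq> PGammaL_on k"
    and "PSL_on k \<subseteq> G"
    and "normal (PSL_on k) ((BijGroup (k_subspaces k :: ('f ^'n) set set))\<lparr>carrier := G\<rparr>)"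
  shows "\<not> IBIS (k_subspaces k :: ('f ^'n) set set) G"
proof -
  obtain K :: "'n set" where K: "card K = k" "k \<le> card (UNIV - K)"
    using assms(3) by (rule obtain_coord_set)
  then have card_K: "2 \<le> card K" "2 \<le> card (UNIV - K)"
    using assms(2) by auto
  have "1 \<le> k"
    using assms(2) by simp
  then obtain Y1 Y2 :: "'n set" and p q where Y: "card Y1 + 1 = k" "card Y2 + 1 = k"
    "Y1 \<inter> Y2 = {}" "p \<notin> Y1" "q \<notin> Y1" "q \<notin> Y2" "q \<noteq> p"
    using assms(3) by (rule obtain_probe_indices)
  obtain ps where ps: "set ps = K \<times> (UNIV - K)" "distinct ps"
    using finite_distinct_list[of "K \<times> (UNIV - K)"] by auto
  obtain E :: "('f ^'n) set list" where E: "set E = insert (probe_subspace Y2 p 1) (range (probe_subspace Y1 p))"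
    using finite_list[of "insert (probe_subspace Y2 p 1) (range (probe_subspace Y1 p)) :: ('f ^'n) set set"]
    by auto
  define F where "F = map (\<lambda>(t, j). coord_subspace (exchange K t j) :: ('f ^'n) set) ps"
  have "is_base (k_subspaces k) G (F @ E)"
    unfolding F_def by (rule is_base_coord_subspace_exchanges_probes[OF assms(4,5) K(1) card_K ps(1) Y E])
  moreover have "coord_subspace K \<in> (k_subspaces k :: ('f ^'n) set set)"
    using K(1) by (rule coord_subspace_in_k_subspaces)
  moreover have "irredundant G (coord_subspace K # F)"
    unfolding F_def using card_K
    by (intro irredundant_coord_subspace_exchanges[OF assms(6) K(1) _ _ ps]) auto
  moreover have "\<forall>g \<in> pw_stab G F. g (coord_subspace K) = coord_subspace K"
    unfolding F_def
    using pw_stab_coord_subspace_exchanges_fixes_coord_subspaces[OF assms(5) K(1) card_K ps(1) _ K(1)]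
    by blast
  ultimately show ?thesis
    by (rule not_IBIS_if_redundant_point)
qed

end
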